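(* Let $\mathfrak A$ be a unital $C^*$-algebra and $\alpha$ an automorphism of $\mathfrak A$. Suppose that there exists a conditional expectation $E:\mathfrak A\to\mathfrak A^\alpha$ of $\mathfrak A$ onto the fixed-point subalgebra $\mathfrak A^\alpha$ such that $$\lim_{n\to+\infty}\frac1n\Big\|\sum_{k=1}^{n}\alpha^{n_k}(x)\Big\|=0$$ for each $x\in\mathfrak A$ satisfying $E(x)=0$ and for each sequence $0\le n_1<n_2<\cdots<n_k<\cdots$ of increasing natural numbers. Then $(\mathfrak A,\alpha)$ is $E$-mixing, i.e. $$\lim_{n\to+\infty}\varphi(\alpha^n(x))=\varphi(E(x))$$ for every $x\in\mathfrak A$ and every state $\varphi$ of $\mathfrak A$.
   Context: $\mathfrak A^\alpha=\{a\in\mathfrak A:\alpha(a)=a\}$. A conditional expectation is a norm-one projection of a $C^*$-algebra onto a $C^*$-subalgebra. *)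

theory Defs
  imports "HOL-Analysis.Analysis"
begin

(* The real scalar multiplication, the norm and completeness are inherited from the library.
   In real_normed_algebra_1 one has 1 ~= 0; the zero algebra has no states
   and no projection of norm one. *)
class unital_cstar_algebra = real_normed_algebra_1 + banach +
  fixes scaleC :: "complex \<Rightarrow> 'a \<Rightarrow> 'a"
    and adj :: "'a \<Rightarrow> 'a"
  assumes scaleC_add_right: "scaleC c (x + y) = scaleC c x + scaleC c y"
    and scaleC_add_left: "scaleC (c + d) x = scaleC c x + scaleC d x"
    and scaleC_scaleC: "scaleC c (scaleC d x) = scaleC (c * d) x"
    and scaleC_of_real: "scaleC (complex_of_real r) x = scaleR r x"
    and norm_scaleC: "norm (scaleC c x) = cmod c * norm x"
    and mult_scaleC_left: "scaleC c x * y = scaleC c (x * y)"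
    and mult_scaleC_right: "x * scaleC c y = scaleC c (x * y)"
    and adj_adj: "adj (adj x) = x"
    and adj_add: "adj (x + y) = adj x + adj y"
    and adj_scaleC: "adj (scaleC c x) = scaleC (cnj c) (adj x)"
    and adj_mult: "adj (x * y) = adj y * adj x"
    and norm_adj_mult_self: "norm (adj x * x) = (norm x)\<^sup>2"

instantiation complex :: unital_cstar_algebra
begin

definition scaleC_complex :: "complex \<Rightarrow> complex \<Rightarrow> complex" where
  "scaleC_complex c x = c * x"

definition adj_complex :: "complex \<Rightarrow> complex" where
  "adj_complex = cnj"

instance
  by standard
    (auto simp: scaleC_complex_def adj_complex_def algebra_simps scaleR_conv_of_real
      norm_mult power2_eq_square)

end

lemma vector_space_scaleC:
  "vector_space (scaleC :: complex \<Rightarrow> 'a \<Rightarrow> 'a::unital_cstar_algebra)"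
proof
  show "scaleC 1 x = x" for x :: 'a
    using scaleC_of_real[of 1 x] by simp
qed (simp_all add: scaleC_add_right scaleC_add_left scaleC_scaleC)

definition cstar_automorphism :: "('a::unital_cstar_algebra \<Rightarrow> 'a) \<Rightarrow> bool" where
  "cstar_automorphism \<alpha> \<longleftrightarrow>
     bij \<alpha> \<and> Vector_Spaces.linear scaleC scaleC \<alpha> \<and>
     (\<forall>x y. \<alpha> (x * y) = \<alpha> x * \<alpha> y) \<and> (\<forall>x. \<alpha> (adj x) = adj (\<alpha> x))"

definition fixed_points :: "('a \<Rightarrow> 'a) \<Rightarrow> 'a set" where
  "fixed_points \<alpha> = {a. \<alpha> a = a}"

definition cstar_subalgebra :: "'a::unital_cstar_algebra set \<Rightarrow> bool" where
  "cstar_subalgebra B \<longleftrightarrow>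
     module.subspace scaleC B \<and> (\<forall>x\<in>B. \<forall>y\<in>B. x * y \<in> B) \<and> (\<forall>x\<in>B. adj x \<in> B) \<and> closed B"

(* onorm is the operator norm; it is only meaningful for bounded maps. *)
definition conditional_expectation_onto ::
  "'a::unital_cstar_algebra set \<Rightarrow> ('a \<Rightarrow> 'a) \<Rightarrow> bool" where
  "conditional_expectation_onto B E \<longleftrightarrow>
     cstar_subalgebra B \<and> Vector_Spaces.linear scaleC scaleC E \<and>
     range E = B \<and> (\<forall>x. E (E x) = E x) \<and> bounded_linear E \<and> onorm E = 1"

(* The requirement cstar_subalgebra in conditional_expectation_onto is no extra
   hypothesis for fixed-point sets. *)
lemma cstar_subalgebra_fixed_points:
  assumes \<alpha>: "cstar_automorphism \<alpha>"
    and E: "bounded_linear E" "range E = fixed_points \<alpha>" "\<forall>x. E (E x) = E x"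
  shows "cstar_subalgebra (fixed_points \<alpha>)"
proof -
  interpret vector_space "scaleC :: complex \<Rightarrow> 'a \<Rightarrow> 'a"
    by (rule vector_space_scaleC)
  interpret Vector_Spaces.linear scaleC scaleC \<alpha>
    using \<alpha> by (simp add: cstar_automorphism_def)
  have "fixed_points \<alpha> = {x. E x = x}"
    unfolding E(2)[symmetric] using E(3) by (auto simp: image_iff) metis
  moreover have "closed {x. E x = x}"
    by (intro closed_Collect_eq continuous_intros linear_continuous_on E(1))
  ultimately have "closed (fixed_points \<alpha>)"
    by simp
  then show ?thesis
    using \<alpha> by (simp add: cstar_subalgebra_def cstar_automorphism_def subspace_def
        fixed_points_def add scale zero)
qed

definition state :: "('a::unital_cstar_algebra \<Rightarrow> complex) \<Rightarrow> bool" where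
  "state \<phi> \<longleftrightarrow>
     Vector_Spaces.linear scaleC (*) \<phi> \<and> (\<forall>x. \<phi> (adj x * x) \<in> \<real>\<^sub>\<ge>\<^sub>0) \<and>
     bounded_linear \<phi> \<and> onorm \<phi> = 1"

definition E_mixing :: "('a::unital_cstar_algebra \<Rightarrow> 'a) \<Rightarrow> ('a \<Rightarrow> 'a) \<Rightarrow> bool" where
  "E_mixing \<alpha> E \<longleftrightarrow>
     (\<forall>x \<phi>. state \<phi> \<longrightarrow> (\<lambda>n. \<phi> ((\<alpha> ^^ n) x)) \<longlonglongrightarrow> \<phi> (E x))"

end

theory Submission
  imports Defs
begin

text \<open>A fixed point splits off, so it suffices to show \<open>\<phi> (\<alpha>\<^sup>n y) \<longlonglongrightarrow> 0\<close> when \<open>E y = 0\<close>. Otherwise one of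
  \<open>\<plusminus>Re \<phi>\<close>, \<open>\<plusminus>Im \<phi>\<close> stays above some \<open>e > 0\<close> along a subsequence of the orbit of \<open>y\<close>. Its Cesaro
  averages then also have a value of at least \<open>e\<close>, although they tend to \<open>0\<close> in norm.\<close>

text \<open>The estimate is one-sided because a lower bound \<open>e\<close> on the values of
  \<open>f\<close> survives averaging, whereas values bounded away from \<open>0\<close> with
  varying sign could cancel.\<close>

lemma eventually_less_of_subseq_averages:
  fixes f :: "'a::real_normed_vector \<Rightarrow> real" and z :: "nat \<Rightarrow> 'a"
  assumes f: "bounded_linear f"
    and avg: "\<And>r :: nat \<Rightarrow> nat. strict_mono r \<Longrightarrow>
      (\<lambda>N. 1 / real N * norm (\<Sum>k=1..N. z (r k))) \<longlonglongrightarrow> 0"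
    and e: "e > 0"
  shows "eventually (\<lambda>n. f (z n) < e) sequentially"
proof (rule ccontr)
  assume "\<not> eventually (\<lambda>n. f (z n) < e) sequentially"
  then have "infinite {n. e \<le> f (z n)}"
    by (simp add: eventually_cofinite not_less flip: cofinite_eq_sequentially)
  then obtain r :: "nat \<Rightarrow> nat" where r: "strict_mono r" "\<And>k. e \<le> f (z (r k))"
    using infinite_enumerate by blast
  obtain K where K: "\<And>x. norm (f x) \<le> norm x * K"
    using bounded_linear.bounded[OF f] by blast
  \<comment> \<open>\<open>N = 0\<close> must be left out: there the right-hand side is
    \<open>0\<close>, since division by zero gives \<open>0\<close>.\<close>
  have "e \<le> K * (1 / real N * norm (\<Sum>k=1..N. z (r k)))" if "N \<ge> 1" for N
  proof -
    have "real N * e = (\<Sum>k=1..N. e)" by simp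
    also have "\<dots> \<le> (\<Sum>k=1..N. f (z (r k)))" by (intro sum_mono r)
    also have "\<dots> = f (\<Sum>k=1..N. z (r k))"
      by (simp add: linear_sum bounded_linear.linear[OF f])
    also have "\<dots> \<le> norm (\<Sum>k=1..N. z (r k)) * K"
      using K[of "\<Sum>k=1..N. z (r k)"] by simp
    finally show ?thesis
      using that by (simp add: field_simps)
  qed
  moreover have "(\<lambda>N. K * (1 / real N * norm (\<Sum>k=1..N. z (r k)))) \<longlonglongrightarrow> K * 0"
    by (intro tendsto_mult_left avg r)
  ultimately have "e \<le> K * 0"
    by (intro Lim_bounded2[where N = 1]) auto
  with e show False by simp
qed

lemma tendsto_zero_of_subseq_averages:
  fixes f :: "'a::real_normed_vector \<Rightarrow> real" and z :: "nat \<Rightarrow> 'a"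
  assumes f: "bounded_linear f"
    and avg: "\<And>r :: nat \<Rightarrow> nat. strict_mono r \<Longrightarrow>
      (\<lambda>N. 1 / real N * norm (\<Sum>k=1..N. z (r k))) \<longlonglongrightarrow> 0"
  shows "(\<lambda>n. f (z n)) \<longlonglongrightarrow> 0"
proof (rule tendstoI)
  fix e :: real
  assume "e > 0"
  have "eventually (\<lambda>n. f (z n) < e) sequentially"
    using f avg \<open>e > 0\<close> by (rule eventually_less_of_subseq_averages)
  \<comment> \<open>The other side comes from the same lemma for the functional
    \<open>- f\<close>.\<close>
  moreover have "eventually (\<lambda>n. - f (z n) < e) sequentially"
    using bounded_linear_minus[OF f] avg \<open>e > 0\<close> by (rule eventually_less_of_subseq_averages)
  ultimately show "eventually (\<lambda>n. dist (f (z n)) 0 < e) sequentially"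
    by eventually_elim auto
qed

theorem proposition2p3:
  fixes \<alpha> E :: "'a::unital_cstar_algebra \<Rightarrow> 'a"
  assumes "cstar_automorphism \<alpha>"
    and "conditional_expectation_onto (fixed_points \<alpha>) E"
    and "\<And>(x::'a) (n :: nat \<Rightarrow> nat). E x = 0 \<Longrightarrow> strict_mono_on {1..} n \<Longrightarrow>
           (\<lambda>N. 1 / real N * norm (\<Sum>k=1..N. (\<alpha> ^^ n k) x)) \<longlonglongrightarrow> 0"
  shows "E_mixing \<alpha> E"
  unfolding E_mixing_def
proof (intro allI impI)
  fix x :: 'a and \<phi> :: "'a \<Rightarrow> complex"
  assume "state \<phi>"
  then have \<phi>: "bounded_linear \<phi>"
    by (simp add: state_def)
  have E: "bounded_linear E" "E (E x) = E x" "\<alpha> (E x) = E x"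
    using assms(2) by (auto simp: conditional_expectation_onto_def fixed_points_def)
  have \<alpha>_add: "\<alpha> (u + v) = \<alpha> u + \<alpha> v" for u v
    using assms(1)
    by (simp add: cstar_automorphism_def Vector_Spaces.linear_iff)
  define y where "y = x - E x"
  have "E y = 0"
    by (simp add: y_def linear_diff bounded_linear.linear E)
  \<comment> \<open>Each application of \<open>\<alpha>\<close> moves only the first summand, since
    \<open>E x\<close> is a fixed point.\<close>
  have orbit: "(\<alpha> ^^ n) x = (\<alpha> ^^ n) y + E x" for n
    by (induction n) (simp_all add: y_def \<alpha>_add E)
  \<comment> \<open>The hypothesis takes sequences indexed from \<open>1\<close>. A
    \<open>strict_mono\<close> map on all naturals restricts to one, and \<open>r 0\<close> does not
    occur in the sums.\<close>
  have avg: "(\<lambda>N. 1 / real N * norm (\<Sum>k=1..N. (\<alpha> ^^ r k) y)) \<longlonglongrightarrow> 0"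
    if "strict_mono r" for r :: "nat \<Rightarrow> nat"
    using that by (intro assms(3) \<open>E y = 0\<close>) (auto simp: strict_mono_on_def strict_mono_def)
  \<comment> \<open>The one-sided argument needs an ordered range, so the real and imaginary parts
    of \<open>\<phi>\<close> are treated as two real functionals.\<close>
  have "(\<lambda>n. Re (\<phi> ((\<alpha> ^^ n) y))) \<longlonglongrightarrow> 0"
    using bounded_linear_compose[OF bounded_linear_Re \<phi>] avg
    by (rule tendsto_zero_of_subseq_averages)
  moreover have "(\<lambda>n. Im (\<phi> ((\<alpha> ^^ n) y))) \<longlonglongrightarrow> 0"
    using bounded_linear_compose[OF bounded_linear_Im \<phi>] avg
    by (rule tendsto_zero_of_subseq_averages)
  ultimately have "(\<lambda>n. \<phi> ((\<alpha> ^^ n) y)) \<longlonglongrightarrow> 0"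
    by (simp add: tendsto_complex_iff)
  then have "(\<lambda>n. \<phi> ((\<alpha> ^^ n) y) + \<phi> (E x)) \<longlonglongrightarrow> 0 + \<phi> (E x)"
    by (intro tendsto_intros)
  then show "(\<lambda>n. \<phi> ((\<alpha> ^^ n) x)) \<longlonglongrightarrow> \<phi> (E x)"
    by (simp add: orbit linear_add bounded_linear.linear[OF \<phi>])
qed

end
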